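(* Consider the Poincaré group, i.e. the semidirect product $\mathbb{R}^{1,3}\rtimes O(1,3)$ (equivalently, with the opposite sign convention, $\mathbb{R}^{3,1}\rtimes O(3,1)$) of the group of space and time translations and the Lorentz group. Then spatial rotations and Lorentz boosts are direct isometries of the Poincaré group, while parity inversion $P$, time reversal $T$, and the full reflection $PT=TP$ are all indirect isometries of the Poincaré group.
   Context: An element of an isometry group $\Gamma$ is called a direct isometry of $\Gamma$ when it can be expressed as a (finite) product of squares of elements of $\Gamma$; otherwise it is an indirect isometry of $\Gamma$. The real Lorentz-Minkowski spacetime is the affine space over $\mathbb{R}^4$, with coordinates $(t,x)$, $t\in\mathbb{R}$, $x\in\mathbb{R}^3$, equipped with the diagonal quadratic form of signature $(1,3)$, $t^2-\|x\|^2$ (or its opposite, of signature $(3,1)$). The Lorentz group is the full orthogonal group of this form (four components); it is generated by spatial rotations ($(t,x)\mapsto(t,Rx)$, $R\in SO(3)$), boosts, parity inversion $P:(t,x)\mapsto(t,-x)$, and time reversal $T:(t,x)\mapsto(-t,x)$. A Lorentz boost is the usual pure Lorentz transformation connecting two uniformly moving bodies: for some unit vector $u\in\mathbb{R}^3$ and rapidity $\theta\in\mathbb{R}$, it acts as a hyperbolic rotation of rapidity $\theta$ in the plane spanned by the time axis and $u$, and fixes the spatial vectors orthogonal to $u$. Elements of the Lorentz group are identified with their images in the Poincaré group. *)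

theory Defs
  imports "HOL-Analysis.Analysis" "HOL-Algebra.Group"
begin

definition prod_of_squares :: "('a, 'b) monoid_scheme \<Rightarrow> 'a list \<Rightarrow> 'a" where
  "prod_of_squares G xs = foldr (\<lambda>x y. (x \<otimes>\<^bsub>G\<^esub> x) \<otimes>\<^bsub>G\<^esub> y) xs \<one>\<^bsub>G\<^esub>"

definition direct_isometry :: "('a, 'b) monoid_scheme \<Rightarrow> 'a \<Rightarrow> bool" where
  "direct_isometry G g \<longleftrightarrow> (\<exists>xs. set xs \<subseteq> carrier G \<and> g = prod_of_squares G xs)"

definition indirect_isometry :: "('a, 'b) monoid_scheme \<Rightarrow> 'a \<Rightarrow> bool" where
  "indirect_isometry G g \<longleftrightarrow> g \<in> carrier G \<and> \<not> direct_isometry G g"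

definition semidirect_product ::
    "('a, 'c) monoid_scheme \<Rightarrow> ('b, 'd) monoid_scheme \<Rightarrow> ('b \<Rightarrow> 'a \<Rightarrow> 'a) \<Rightarrow> ('a \<times> 'b) monoid" where
  "semidirect_product N H \<phi> =
     \<lparr>carrier = carrier N \<times> carrier H,
      monoid.mult = (\<lambda>(a, f) (b, g). (a \<otimes>\<^bsub>N\<^esub> \<phi> f b, f \<otimes>\<^bsub>H\<^esub> g)),
      one = (\<one>\<^bsub>N\<^esub>, \<one>\<^bsub>H\<^esub>)\<rparr>"

type_synonym spacetime = "real \<times> (real ^ 3)"

definition minkowski_form :: "spacetime \<Rightarrow> real" where
  "minkowski_form = (\<lambda>(t, x). t\<^sup>2 - (norm x)\<^sup>2)"

definition orthogonal_group :: "(spacetime \<Rightarrow> real) \<Rightarrow> (spacetime \<Rightarrow> spacetime) monoid" where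
  "orthogonal_group q =
     \<lparr>carrier = {L. linear L \<and> bij L \<and> (\<forall>v. q (L v) = q v)},
      monoid.mult = (\<circ>), one = id\<rparr>"

definition translation_group :: "spacetime monoid" where
  "translation_group = \<lparr>carrier = UNIV, monoid.mult = (+), one = 0\<rparr>"

text \<open>The pair \<open>(a, L)\<close> stands for the affine map sending \<open>v\<close> to \<open>a + L v\<close>.\<close>

definition poincare_group ::
    "(spacetime \<Rightarrow> real) \<Rightarrow> (spacetime \<times> (spacetime \<Rightarrow> spacetime)) monoid" where
  "poincare_group q = semidirect_product translation_group (orthogonal_group q) (\<lambda>L v. L v)"

definition of_lorentz :: "(spacetime \<Rightarrow> spacetime) \<Rightarrow> spacetime \<times> (spacetime \<Rightarrow> spacetime)" where
  "of_lorentz L = (0, L)"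

definition spatial_rotation :: "real ^ 3 ^ 3 \<Rightarrow> spacetime \<Rightarrow> spacetime" where
  "spatial_rotation R = (\<lambda>(t, x). (t, R *v x))"

text \<open>For a unit vector \<open>u\<close>, the vector \<open>x\<close> is split into its component along \<open>u\<close>, which is
  hyperbolically rotated together with \<open>t\<close>, and its component orthogonal to \<open>u\<close>, which is fixed.\<close>

definition lorentz_boost :: "real ^ 3 \<Rightarrow> real \<Rightarrow> spacetime \<Rightarrow> spacetime" where
  "lorentz_boost u \<theta> = (\<lambda>(t, x).
     (cosh \<theta> * t + sinh \<theta> * (u \<bullet> x),
      (sinh \<theta> * t + cosh \<theta> * (u \<bullet> x)) *\<^sub>R u + (x - (u \<bullet> x) *\<^sub>R u)))"

definition parity_inversion :: "spacetime \<Rightarrow> spacetime" where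
  "parity_inversion = (\<lambda>(t, x). (t, - x))"

definition time_reversal :: "spacetime \<Rightarrow> spacetime" where
  "time_reversal = (\<lambda>(t, x). (- t, x))"

lemma group_orthogonal_group: "group (orthogonal_group q)"
proof (rule groupI)
  fix L assume L: "L \<in> carrier (orthogonal_group q)"
  then have *: "linear L" "bij L" "\<And>v. q (L v) = q v"
    by (auto simp: orthogonal_group_def)
  have "linear (inv_into UNIV L)"
    using * by (simp add: bij_is_inj bij_is_surj inj_linear_imp_inv_linear)
  moreover have "q (inv_into UNIV L v) = q v" for v
    using *(3)[of "inv_into UNIV L v"] *(2) by (simp add: bij_is_surj surj_f_inv_f)
  ultimately have "inv_into UNIV L \<in> carrier (orthogonal_group q)"
    using * by (simp add: orthogonal_group_def bij_imp_bij_inv)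
  moreover have "inv_into UNIV L \<circ> L = id"
    using * by (simp add: bij_is_inj)
  ultimately show "\<exists>M\<in>carrier (orthogonal_group q).
      M \<otimes>\<^bsub>orthogonal_group q\<^esub> L = \<one>\<^bsub>orthogonal_group q\<^esub>"
    by (auto simp: orthogonal_group_def)
qed (auto simp: orthogonal_group_def linear_compose bij_comp o_assoc linear_id
    simp del: split_paired_All)

lemma group_poincare_group: "group (poincare_group q)"
proof -
  interpret O: group "orthogonal_group q" by (rule group_orthogonal_group)
  have lin: "linear L" if "L \<in> carrier (orthogonal_group q)" for L
    using that by (simp add: orthogonal_group_def)
  have comp: "(L \<otimes>\<^bsub>orthogonal_group q\<^esub> M) v = L (M v)" for L M v
    by (simp add: orthogonal_group_def)
  have one: "\<one>\<^bsub>orthogonal_group q\<^esub> v = v" for v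
    by (simp add: orthogonal_group_def)
  show ?thesis
  proof (rule groupI)
    fix x assume "x \<in> carrier (poincare_group q)"
    then obtain a L where x: "x = (a, L)" and L: "L \<in> carrier (orthogonal_group q)"
      by (auto simp: poincare_group_def semidirect_product_def)
    let ?M = "inv\<^bsub>orthogonal_group q\<^esub> L"
    have "(- ?M a, ?M) \<otimes>\<^bsub>poincare_group q\<^esub> x = \<one>\<^bsub>poincare_group q\<^esub>"
      using L by (simp add: x poincare_group_def semidirect_product_def translation_group_def)
    moreover have "(- ?M a, ?M) \<in> carrier (poincare_group q)"
      using L by (simp add: poincare_group_def semidirect_product_def translation_group_def)
    ultimately show "\<exists>y\<in>carrier (poincare_group q).
        y \<otimes>\<^bsub>poincare_group q\<^esub> x = \<one>\<^bsub>poincare_group q\<^esub>" by blast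
  qed (auto simp: poincare_group_def semidirect_product_def translation_group_def
        O.m_assoc comp one lin linear_add)
qed

end

theory Submission imports Defs "HOL-Analysis.Cross3"
begin

text \<open>A square in \<open>O(1,3)\<close> has positive determinant, and it is orthochronous because the sign of
  the time component of \<open>L (1, 0)\<close> is multiplicative in \<open>L\<close>; both properties pass to products.
  The determinant excludes \<open>P\<close>, the time orientation excludes \<open>T\<close> and \<open>PT\<close>. Conversely, by
  Euler's theorem every rotation turns about an axis, so that rotations and boosts belong to
  one-parameter groups and are squares of the element with half the parameter.\<close>

section \<open>Rotations of three-space\<close>

unbundle cross3_syntax

text \<open>Rodrigues' formula: for a unit vector \<open>u\<close>, the rotation about the axis
  \<open>u\<close> by the angle \<theta>. The closed form turns halving the angle into a
  computation.\<close>

definition axis_rotation :: "real ^ 3 \<Rightarrow> real \<Rightarrow> real ^ 3 \<Rightarrow> real ^ 3" where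
  "axis_rotation u \<theta> x = cos \<theta> *\<^sub>R x + sin \<theta> *\<^sub>R (u \<times> x) + ((1 - cos \<theta>) * (u \<bullet> x)) *\<^sub>R u"

lemma linear_axis_rotation: "linear (axis_rotation u \<theta>)"
  by (rule linearI)
    (simp_all add: axis_rotation_def cross_add_right cross_mult_right algebra_simps)

lemma cross_cross_right: "x \<times> (y \<times> z) = (x \<bullet> z) *\<^sub>R y - (x \<bullet> y) *\<^sub>R z" for x y z :: "real ^ 3"
  by (simp add: cross3_simps forall_3)

text \<open>Crossing with \<open>u\<close> is a quarter turn on the plane orthogonal to
  \<open>u\<close>, so doing it twice negates the component of \<open>x\<close> in that plane and
  kills the one along \<open>u\<close>.\<close>

lemma cross_cross_unit:
  fixes u x :: "real ^ 3"
  assumes "norm u = 1"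
  shows "u \<times> (u \<times> x) = (u \<bullet> x) *\<^sub>R u - x"
  using assms by (simp add: cross_cross_right norm_eq_1)

lemma axis_rotation_add:
  assumes "norm u = 1"
  shows "axis_rotation u \<alpha> (axis_rotation u \<beta> x) = axis_rotation u (\<alpha> + \<beta>) x"
proof -
  have *: "u \<bullet> u = 1" "u \<times> u = 0" "u \<bullet> (u \<times> x) = 0" "u \<times> (u \<times> x) = (u \<bullet> x) *\<^sub>R u - x"
    using assms by (simp_all add: norm_eq_1 dot_cross_self cross_cross_unit)
  have inner: "u \<bullet> axis_rotation u \<beta> x = u \<bullet> x"
    using * by (simp add: axis_rotation_def inner_add_right algebra_simps)
  have cross: "u \<times> axis_rotation u \<beta> x = cos \<beta> *\<^sub>R (u \<times> x) + sin \<beta> *\<^sub>R ((u \<bullet> x) *\<^sub>R u - x)"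
    using * by (simp add: axis_rotation_def cross_add_right cross_mult_right)
  \<comment> \<open>Only the outer rotation is unfolded, so that \<open>inner\<close> and
    \<open>cross\<close> apply to the inner rotation as a whole; the angle addition formulas do the
    rest.\<close>
  have "axis_rotation u \<alpha> (axis_rotation u \<beta> x) =
      cos \<alpha> *\<^sub>R axis_rotation u \<beta> x
      + sin \<alpha> *\<^sub>R (cos \<beta> *\<^sub>R (u \<times> x) + sin \<beta> *\<^sub>R ((u \<bullet> x) *\<^sub>R u - x))
      + ((1 - cos \<alpha>) * (u \<bullet> x)) *\<^sub>R u"
    by (simp only: axis_rotation_def[of u \<alpha>] inner cross)
  then show ?thesis
    by (simp add: axis_rotation_def cos_add sin_add algebra_simps)
qed

text \<open>The square expands into inner products of \<open>x\<close>, \<open>u\<close> and their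
  cross product. Lagrange's identity gives the squared length of the latter, and sin^2 + cos^2 = 1
  collapses the sum.\<close>

lemma norm_axis_rotation:
  assumes "norm u = 1"
  shows "norm (axis_rotation u \<theta> x) = norm x"
proof -
  have *: "u \<bullet> u = 1" "u \<bullet> (u \<times> x) = 0" "x \<bullet> (u \<times> x) = 0" "(u \<times> x) \<bullet> x = 0" "(u \<times> x) \<bullet> u = 0"
    "x \<bullet> u = u \<bullet> x"
    using assms by (simp_all add: norm_eq_1 dot_cross_self inner_commute)
  have cross: "(u \<times> x) \<bullet> (u \<times> x) = x \<bullet> x - (u \<bullet> x)\<^sup>2"
    using norm_cross_dot[of u x] assms by (simp add: power2_norm_eq_inner[symmetric])
  have "axis_rotation u \<theta> x \<bullet> axis_rotation u \<theta> x = x \<bullet> x"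
    unfolding axis_rotation_def inner_add_left inner_add_right inner_scaleR_left inner_scaleR_right
      * cross
    using sin_cos_squared_add[of \<theta>] by algebra
  then show ?thesis
    by (simp add: norm_eq)
qed

section \<open>Euler's rotation theorem\<close>

lemma det_uminus_3: "det (- A) = - det A" for A :: "real ^ 3 ^ 3"
  by (simp add: det_3 algebra_simps)

text \<open>Multiplying R - 1 by the transpose of R, of determinant 1, turns it into minus the
  transpose of R - 1. In odd dimension this gives det (R - 1) = - det (R - 1), so R - 1 is singular,
  and a kernel vector can be normalised.\<close>

lemma rotation_matrix_fixes_unit_vector:
  fixes R :: "real ^ 3 ^ 3"
  assumes "rotation_matrix R"
  obtains u where "norm u = 1" "R *v u = u"
proof -
  from assms have R: "transpose R ** R = mat 1" "det R = 1"
    by (auto simp: rotation_matrix_def orthogonal_matrix)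
  have "det (R - mat 1) = det (transpose R ** (R - mat 1))"
    using R by (simp add: det_mul det_transpose)
  also have "transpose R ** (R - mat 1) = mat 1 - transpose R"
    using R(1) matrix_add_ldistrib[of "transpose R" "R - mat 1" "mat 1"] by (simp add: eq_diff_eq)
  also have "\<dots> = - transpose (R - mat 1)"
    by (simp add: vec_eq_iff transpose_def mat_def)
  also have "det (- transpose (R - mat 1)) = - det (R - mat 1)"
    by (simp only: det_uminus_3 det_transpose)
  finally have "det (R - mat 1) = 0"
    by simp
  then have "\<not> (\<exists>B. B ** (R - mat 1) = mat 1)"
    using invertible_det_nz invertible_left_inverse by blast
  then obtain x where x: "(R - mat 1) *v x = 0" "x \<noteq> 0"
    unfolding matrix_left_invertible_ker by blast
  show thesis
  proof
    show "norm (x /\<^sub>R norm x) = 1"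
      using x by simp
    show "R *v (x /\<^sub>R norm x) = x /\<^sub>R norm x"
      using x by (simp add: matrix_vector_mult_diff_rdistrib matrix_vector_mult_scaleR)
  qed
qed

text \<open>Let w be the cross product of \<open>u\<close> and \<open>v\<close>. Crossing
  \<open>x\<close> twice with w yields the component along w minus \<open>x\<close>, and also, by
  the triple product formula, minus the components along \<open>u\<close> and \<open>v\<close>.
  Comparing the two gives the expansion.\<close>

lemma orthonormal_expansion_cross:
  fixes u v x :: "real ^ 3"
  assumes "norm u = 1" "norm v = 1" "u \<bullet> v = 0"
  shows "x = (u \<bullet> x) *\<^sub>R u + (v \<bullet> x) *\<^sub>R v + ((u \<times> v) \<bullet> x) *\<^sub>R (u \<times> v)"
proof -
  have n: "norm (u \<times> v) = 1"
    using norm_cross_dot[of u v] assms by (simp add: abs_square_eq_1)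
  have *: "u \<bullet> u = 1" "v \<bullet> v = 1" "v \<bullet> u = 0"
    using assms by (simp_all add: norm_eq_1 inner_commute)
  have cu: "(u \<times> v) \<times> u = v" and cv: "(u \<times> v) \<times> v = - u"
    using assms * cross_skew[of "u \<times> v"] by (simp_all add: cross_cross_right)
  have cx: "(u \<times> v) \<times> x = (u \<bullet> x) *\<^sub>R v - (v \<bullet> x) *\<^sub>R u"
    using cross_skew[of "u \<times> v" x] by (simp add: cross_cross_right inner_commute)
  have "(u \<times> v) \<times> ((u \<times> v) \<times> x) = - (u \<bullet> x) *\<^sub>R u - (v \<bullet> x) *\<^sub>R v"
    unfolding cx by (simp add: Cross3.right_diff_distrib cross_mult_right cu cv)
  moreover have "(u \<times> v) \<times> ((u \<times> v) \<times> x) = ((u \<times> v) \<bullet> x) *\<^sub>R (u \<times> v) - x"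
    using n by (rule cross_cross_unit)
  ultimately show ?thesis
    by (simp add: algebra_simps)
qed

text \<open>With \<open>u\<close> fixed by \<open>R\<close>, the angle is read off from the image of
  one unit vector \<open>v\<close> orthogonal to \<open>u\<close>. Two linear maps agree once they
  agree on \<open>u\<close>, \<open>v\<close> and their cross product.\<close>

theorem rotation_matrix_eq_axis_rotation:
  assumes "rotation_matrix R"
  obtains u \<theta> where "norm u = 1" "(*v) R = axis_rotation u \<theta>"
proof -
  obtain u where u: "norm u = 1" "R *v u = u"
    using rotation_matrix_fixes_unit_vector[OF assms] .
  obtain y where "y \<noteq> 0" "orthogonal u y"
    using orthogonal_to_vector_exists[of u] by auto
  then obtain v where v: "norm v = 1" "u \<bullet> v = 0"
    by (intro that[of "y /\<^sub>R norm y"]) (auto simp: orthogonal_def)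
  define w where "w = u \<times> v"
  have uu: "u \<bullet> u = 1" and vv: "v \<bullet> v = 1"
    using u v by (simp_all add: norm_eq_1)
  have uw: "u \<times> w = - v" "u \<bullet> w = 0"
    using cross_cross_unit[OF u(1), of v] v by (simp_all add: w_def dot_cross_self)
  have "orthogonal_matrix R"
    using assms by (simp add: rotation_matrix_def)
  then have orth: "(R *v x) \<bullet> (R *v y) = x \<bullet> y" for x y
    using orthogonal_transformation_matrix[of "(*v) R"]
    by (simp add: orthogonal_transformation_def matrix_vector_mul_linear)
  have "u \<bullet> (R *v v) = 0"
    using orth[of u v] u v by simp
  then have Rv: "R *v v = (v \<bullet> (R *v v)) *\<^sub>R v + (w \<bullet> (R *v v)) *\<^sub>R w"
    using orthonormal_expansion_cross[OF u(1) v, of "R *v v"] by (simp add: w_def)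
  have "w \<bullet> w = 1" "v \<bullet> w = 0"
    using norm_cross_dot[of u v] u v by (simp_all add: w_def dot_cross_self power2_norm_eq_inner)
  \<comment> \<open>Occurrences 3 and 4 of \<open>R *v v\<close> are those on the right-hand side;
    the coordinates on the left stay as they are. They form a point of the unit circle, which
    provides \<theta>.\<close>
  then have "(v \<bullet> (R *v v))\<^sup>2 + (w \<bullet> (R *v v))\<^sup>2 = (R *v v) \<bullet> (R *v v)"
    using vv by (subst (3 4) Rv)
      (simp add: inner_add_left inner_add_right inner_commute power2_eq_square)
  also have "\<dots> = 1"
    using orth vv by simp
  finally obtain \<theta> where \<theta>: "v \<bullet> (R *v v) = cos \<theta>" "w \<bullet> (R *v v) = sin \<theta>"
    using sincos_total_2pi by metis
  have eq_u: "R *v u = axis_rotation u \<theta> u"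
    using u uu by (simp add: axis_rotation_def flip: scaleR_add_left)
  have eq_v: "R *v v = axis_rotation u \<theta> v"
    using Rv v by (simp add: \<theta> axis_rotation_def flip: w_def)
  \<comment> \<open>Rotation matrices preserve the cross product, so the image of \<open>w\<close>
    is determined by those of \<open>u\<close> and \<open>v\<close>.\<close>
  have "R *v w = u \<times> (R *v v)"
    using cross_rotation_matrix[OF assms, of u v] u by (simp add: w_def)
  then have eq_w: "R *v w = axis_rotation u \<theta> w"
    using uw v w_def by (simp add: eq_v axis_rotation_def cross_add_right cross_mult_right)
  have "R *v x = axis_rotation u \<theta> x" for x
  proof -
    interpret A: linear "axis_rotation u \<theta>"
      by (rule linear_axis_rotation)
    show ?thesis
      by (subst (1 2) orthonormal_expansion_cross[OF u(1) v, of x])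
        (simp only: A.add A.scaleR matrix_vector_right_distrib matrix_vector_mult_scaleR
          eq_u eq_v eq_w flip: w_def)
  qed
  with u show thesis
    by (intro that[of u \<theta>]) auto
qed

unbundle no cross3_syntax

section \<open>The Lorentz group\<close>

definition minkowski_inner :: "spacetime \<Rightarrow> spacetime \<Rightarrow> real" where
  "minkowski_inner v w = fst v * fst w - snd v \<bullet> snd w"

lemma minkowski_form_add:
  "minkowski_form (v + w) = minkowski_form v + minkowski_form w + 2 * minkowski_inner v w"
  by (simp add: minkowski_form_def minkowski_inner_def case_prod_beta power2_norm_eq_inner
      inner_add_left inner_add_right inner_commute power2_sum algebra_simps)

text \<open>Bijectivity comes for free: the form is nondegenerate, so a linear map preserving it is
  injective, hence surjective in finite dimension.\<close>

lemma carrier_orthogonal_groupI: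
  assumes "linear L" and pres: "\<And>v. minkowski_form (L v) = minkowski_form v"
  shows "L \<in> carrier (orthogonal_group minkowski_form)"
proof -
  have "v = 0" if "L v = 0" for v
  proof -
    have "minkowski_form (v + w) = minkowski_form w" for w
      using pres[of "v + w"] pres[of w] that assms(1) by (simp add: linear_add)
    \<comment> \<open>For v = (t, x), the choice w = (t, -x) gives 4 t^2 = t^2 - |x|^2, and w = 0
      gives t^2 = |x|^2; together they force v = 0.\<close>
    from this[of "(fst v, - snd v)"] this[of 0] show ?thesis
      by (cases v) (simp add: minkowski_form_def zero_prod_def)
  qed
  then have "inj L"
    using assms(1) linear_injective_0 by blast
  then have "bij L"
    using assms(1) linear_injective_imp_surjective by (auto simp: bij_def)
  then show ?thesis
    using assms by (simp add: orthogonal_group_def)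
qed

text \<open>By polarization the bilinear form is determined by the quadratic form, so it is
  preserved along with it.\<close>

lemma minkowski_inner_orthogonal:
  assumes "L \<in> carrier (orthogonal_group minkowski_form)"
  shows "minkowski_inner (L v) (L w) = minkowski_inner v w"
proof -
  have "linear L" and pres: "\<And>v. minkowski_form (L v) = minkowski_form v"
    using assms unfolding orthogonal_group_def by auto
  then show ?thesis
    using minkowski_form_add[of v w] minkowski_form_add[of "L v" "L w"] pres[of "v + w"]
    by (simp add: linear_add)
qed

text \<open>Both signature conventions define the same group, which reduces everything to signature
  (1,3).\<close>

lemma orthogonal_group_uminus: "orthogonal_group (\<lambda>v. - q v) = orthogonal_group q"
  by (simp add: orthogonal_group_def)

lemma poincare_group_uminus: "poincare_group (\<lambda>v. - q v) = poincare_group q"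
  by (simp add: poincare_group_def orthogonal_group_uminus)

lemma spatial_in_orthogonal_group:
  assumes "linear f" "\<And>x. norm (f x) = norm x"
  shows "(\<lambda>(t, x). (t, f x)) \<in> carrier (orthogonal_group minkowski_form)"
proof (rule carrier_orthogonal_groupI)
  show "linear (\<lambda>(t, x). (t, f x))"
    using assms(1) by (auto intro!: linearI simp: linear_add linear_scale)
qed (auto simp: minkowski_form_def assms(2))

section \<open>Lorentz boosts\<close>

lemma linear_lorentz_boost: "linear (lorentz_boost u \<theta>)"
  by (rule linearI)
    (simp_all add: lorentz_boost_def case_prod_beta prod_eq_iff inner_add_right distrib_left
      scaleR_add_left scaleR_add_right scaleR_diff_right mult.left_commute)

lemma lorentz_boost_in_orthogonal_group:
  assumes "norm u = 1"
  shows "lorentz_boost u \<theta> \<in> carrier (orthogonal_group minkowski_form)"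
proof (rule carrier_orthogonal_groupI)
  fix v :: spacetime
  obtain t x where v: "v = (t, x)" by force
  have uu: "u \<bullet> u = 1" using assms by (simp add: norm_eq_1)
  \<comment> \<open>The part of \<open>x\<close> that the boost fixes. Being orthogonal to
    \<open>u\<close>, it splits off by Pythagoras, leaving a hyperbolic rotation of the pair
    \<open>t\<close>, \<open>u \<bullet> x\<close>.\<close>
  define y where "y = x - (u \<bullet> x) *\<^sub>R u"
  have uy: "u \<bullet> y = 0" "y \<bullet> u = 0"
    using uu by (simp_all add: y_def inner_diff_right inner_diff_left inner_commute)
  have norm: "(norm (a *\<^sub>R u + y))\<^sup>2 = a\<^sup>2 + y \<bullet> y" for a
    using uu uy
    by (simp add: power2_norm_eq_inner inner_add_left inner_add_right) (simp add: power2_eq_square)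
  have x: "(norm x)\<^sup>2 = (u \<bullet> x)\<^sup>2 + y \<bullet> y"
    using norm[of "u \<bullet> x"] by (simp add: y_def)
  have "(cosh \<theta> * t + sinh \<theta> * (u \<bullet> x))\<^sup>2 - (sinh \<theta> * t + cosh \<theta> * (u \<bullet> x))\<^sup>2
      = ((cosh \<theta>)\<^sup>2 - (sinh \<theta>)\<^sup>2) * (t\<^sup>2 - (u \<bullet> x)\<^sup>2)"
    by (simp add: power2_eq_square algebra_simps)
  then show "minkowski_form (lorentz_boost u \<theta> v) = minkowski_form v"
    by (simp add: v minkowski_form_def lorentz_boost_def norm x cosh_square_eq flip: y_def)
qed (rule linear_lorentz_boost)

text \<open>Boosts along one fixed direction form a one-parameter group, by the addition formulas
  for cosh and sinh.\<close>

lemma lorentz_boost_add: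
  assumes "norm u = 1"
  shows "lorentz_boost u \<alpha> \<circ> lorentz_boost u \<beta> = lorentz_boost u (\<alpha> + \<beta>)"
  using assms
  by (simp add: fun_eq_iff lorentz_boost_def norm_eq_1 inner_add_right inner_diff_right cosh_add sinh_add)
    (simp add: distrib_left distrib_right scaleR_add_left)

lemma parity_inversion_in_orthogonal_group:
  "parity_inversion \<in> carrier (orthogonal_group minkowski_form)"
  unfolding parity_inversion_def by (rule spatial_in_orthogonal_group) (simp_all add: linear_uminus)

lemma time_reversal_in_orthogonal_group:
  "time_reversal \<in> carrier (orthogonal_group minkowski_form)"
proof (rule carrier_orthogonal_groupI)
  show "linear time_reversal"
    by (rule linearI) (auto simp: time_reversal_def)
qed (auto simp: time_reversal_def minkowski_form_def)

lemma comp_in_orthogonal_group: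
  assumes "L \<in> carrier (orthogonal_group q)" "M \<in> carrier (orthogonal_group q)"
  shows "L \<circ> M \<in> carrier (orthogonal_group q)"
  using monoid.m_closed[OF group.is_monoid[OF group_orthogonal_group] assms]
  by (simp add: orthogonal_group_def)

section \<open>Time orientation\<close>

text \<open>For timelike vectors the time parts dominate: by Cauchy-Schwarz the spatial inner
  product is smaller in absolute value than the product of the time components, so it cannot change
  the sign.\<close>

lemma sgn_minkowski_inner_timelike:
  assumes "minkowski_form v > 0" "minkowski_form w > 0"
  shows "sgn (minkowski_inner v w) = sgn (fst v) * sgn (fst w)"
proof -
  obtain t x s y where vw: "v = (t, x)" "w = (s, y)" by force
  have "norm x < \<bar>t\<bar>" "norm y < \<bar>s\<bar>"
    using assms power2_less_imp_less[of "norm x" "\<bar>t\<bar>"] power2_less_imp_less[of "norm y" "\<bar>s\<bar>"]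
    by (simp_all add: vw minkowski_form_def)
  then have "norm x * norm y < \<bar>t * s\<bar>"
    unfolding abs_mult by (rule mult_strict_mono') simp_all
  then have "\<bar>x \<bullet> y\<bar> < \<bar>t * s\<bar>"
    using Cauchy_Schwarz_ineq2[of x y] by linarith
  then have "sgn (t * s - x \<bullet> y) = sgn (t * s)"
    by (auto simp: sgn_if abs_if split: if_splits)
  then show ?thesis
    by (simp add: vw minkowski_inner_def sgn_mult)
qed

text \<open>The sign is taken because the time component itself is not multiplicative in
  \<open>L\<close>.\<close>

definition time_orientation :: "(spacetime \<Rightarrow> spacetime) \<Rightarrow> real" where
  "time_orientation L = sgn (fst (L (1, 0)))"

text \<open>With e = (1, 0), invariance equates the inner product of L (M e) and L e with that of M
  e and e, the time component of M e. Both images under L are timelike, so the sign of the former is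
  a product of two orientations.\<close>

lemma time_orientation_comp:
  assumes L: "L \<in> carrier (orthogonal_group minkowski_form)"
    and M: "M \<in> carrier (orthogonal_group minkowski_form)"
  shows "time_orientation (L \<circ> M) = time_orientation L * time_orientation M"
proof -
  let ?e = "(1, 0) :: spacetime"
  have pos: "minkowski_form (K ?e) > 0" if "K \<in> carrier (orthogonal_group minkowski_form)" for K
    using that by (simp add: orthogonal_group_def) (simp add: minkowski_form_def)
  have LM: "L \<circ> M \<in> carrier (orthogonal_group minkowski_form)"
    using L M by (rule comp_in_orthogonal_group)
  have "sgn (minkowski_inner (L (M ?e)) (L ?e)) = time_orientation (L \<circ> M) * time_orientation L"
    using sgn_minkowski_inner_timelike[of "L (M ?e)" "L ?e"] pos[OF LM] pos[OF L]
    by (simp add: time_orientation_def)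
  also have "minkowski_inner (L (M ?e)) (L ?e) = fst (M ?e)"
    using minkowski_inner_orthogonal[OF L] by (simp add: minkowski_inner_def)
  finally have "time_orientation M = time_orientation (L \<circ> M) * time_orientation L"
    by (simp add: time_orientation_def)
  \<comment> \<open>The inner product of \<open>L ?e\<close> with itself is 1, so the orientation of
    \<open>L\<close> is its own inverse and can be moved across the equation above.\<close>
  moreover have "time_orientation L * time_orientation L = 1"
    using sgn_minkowski_inner_timelike[OF pos[OF L] pos[OF L]] pos[OF L]
      minkowski_inner_orthogonal[OF L, of ?e ?e]
    by (simp add: time_orientation_def minkowski_inner_def)
  ultimately show ?thesis
    by (simp add: mult.commute mult.left_commute)
qed

section \<open>Determinant\<close>

text \<open>Since \<open>det\<close> takes square matrices, spacetime is given coordinates in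
  \<open>real ^ 4\<close>, with time at index 1.\<close>

definition spacetime_of_vec :: "real ^ 4 \<Rightarrow> spacetime" where
  "spacetime_of_vec v = (v $ 1, vector [v $ 2, v $ 3, v $ 4])"

definition vec_of_spacetime :: "spacetime \<Rightarrow> real ^ 4" where
  "vec_of_spacetime = (\<lambda>(t, x). vector [t, x $ 1, x $ 2, x $ 3])"

lemma vector_4_nth:
  "(vector [a, b, c, d] :: 'a :: zero ^ 4) $ 1 = a"
  "(vector [a, b, c, d] :: 'a :: zero ^ 4) $ 2 = b"
  "(vector [a, b, c, d] :: 'a :: zero ^ 4) $ 3 = c"
  "(vector [a, b, c, d] :: 'a :: zero ^ 4) $ 4 = d"
  by (simp_all add: vector_def)

lemma spacetime_of_vec_of_spacetime: "spacetime_of_vec (vec_of_spacetime v) = v"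
  by (simp add: spacetime_of_vec_def vec_of_spacetime_def vector_4_nth case_prod_beta
      prod_eq_iff vec_eq_iff forall_3)

lemma vec_of_spacetime_of_vec: "vec_of_spacetime (spacetime_of_vec v) = v"
  by (simp add: spacetime_of_vec_def vec_of_spacetime_def vector_4_nth vec_eq_iff forall_4)

lemma linear_spacetime_of_vec: "linear spacetime_of_vec"
  by (rule linearI) (simp_all add: spacetime_of_vec_def vec_eq_iff forall_3)

lemma linear_vec_of_spacetime: "linear vec_of_spacetime"
  by (rule linearI) (auto simp: vec_of_spacetime_def vec_eq_iff forall_4 vector_4_nth)

definition spacetime_det :: "(spacetime \<Rightarrow> spacetime) \<Rightarrow> real" where
  "spacetime_det L = det (matrix (vec_of_spacetime \<circ> L \<circ> spacetime_of_vec))"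

text \<open>The two coordinate changes cancel between the factors, so multiplicativity of
  \<open>det\<close> carries over.\<close>

lemma spacetime_det_comp:
  assumes "linear L" "linear M"
  shows "spacetime_det (L \<circ> M) = spacetime_det L * spacetime_det M"
proof -
  have "vec_of_spacetime \<circ> (L \<circ> M) \<circ> spacetime_of_vec =
      (vec_of_spacetime \<circ> L \<circ> spacetime_of_vec) \<circ> (vec_of_spacetime \<circ> M \<circ> spacetime_of_vec)"
    by (simp add: fun_eq_iff spacetime_of_vec_of_spacetime)
  then show ?thesis
    using assms
    by (simp add: spacetime_det_def matrix_compose det_mul linear_compose
        linear_spacetime_of_vec linear_vec_of_spacetime)
qed

lemma spacetime_det_id: "spacetime_det id = 1"
proof -
  have "vec_of_spacetime \<circ> id \<circ> spacetime_of_vec = id"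
    by (simp add: fun_eq_iff vec_of_spacetime_of_vec)
  then show ?thesis
    by (simp add: spacetime_det_def matrix_id)
qed

text \<open>In coordinates this is diag(1, -1, -1, -1), and the number of spatial dimensions is
  odd.\<close>

lemma spacetime_det_parity_inversion: "spacetime_det parity_inversion = - 1"
proof -
  let ?A = "matrix (vec_of_spacetime \<circ> parity_inversion \<circ> spacetime_of_vec)"
  have A: "?A $ i $ j = (if i = j then if i = 1 then 1 else - 1 else 0)" for i j
    using exhaust_4[of i] exhaust_4[of j]
    by (auto simp: matrix_def vec_of_spacetime_def parity_inversion_def spacetime_of_vec_def
        vector_4_nth axis_def)
  then have "det ?A = (\<Prod>i\<in>UNIV. ?A $ i $ i)"
    by (intro det_diagonal) auto
  also have "\<dots> = - 1"
    unfolding UNIV_4 by (simp add: A)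
  finally show ?thesis
    by (simp add: spacetime_det_def)
qed

section \<open>Direct isometries\<close>

text \<open>The translation part of the product is 0 + L 0, which vanishes by linearity.\<close>

lemma mult_of_lorentz:
  assumes "linear L"
  shows "of_lorentz L \<otimes>\<^bsub>poincare_group q\<^esub> of_lorentz M = of_lorentz (L \<circ> M)"
  using assms by (simp add: poincare_group_def semidirect_product_def translation_group_def
      orthogonal_group_def of_lorentz_def linear_0)

lemma of_lorentz_in_poincare_group:
  "of_lorentz L \<in> carrier (poincare_group q) \<longleftrightarrow> L \<in> carrier (orthogonal_group q)"
  by (simp add: poincare_group_def semidirect_product_def translation_group_def of_lorentz_def)

lemma direct_isometry_square:
  assumes "group G" "g \<in> carrier G"
  shows "direct_isometry G (g \<otimes>\<^bsub>G\<^esub> g)"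
proof -
  interpret group G by fact
  show ?thesis
    unfolding direct_isometry_def using assms(2)
    by (intro exI[of _ "[g]"]) (simp add: prod_of_squares_def)
qed

lemma direct_isometry_of_lorentz_square:
  assumes "L \<in> carrier (orthogonal_group q)"
  shows "direct_isometry (poincare_group q) (of_lorentz (L \<circ> L))"
proof -
  have "linear L"
    using assms by (simp add: orthogonal_group_def)
  then show ?thesis
    using direct_isometry_square[OF group_poincare_group, of "of_lorentz L" q] assms
    by (simp add: mult_of_lorentz of_lorentz_in_poincare_group)
qed

text \<open>The squared elements may contain translations, but \<open>snd\<close> is a homomorphism
  onto the Lorentz part. Composed with it, \<psi> is a real character of the whole group, and
  nonzero real numbers have positive squares.\<close>

lemma direct_isometry_character_pos:
  fixes \<psi> :: "(spacetime \<Rightarrow> spacetime) \<Rightarrow> real"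
  assumes one: "\<psi> id = 1"
    and comp: "\<And>L M. L \<in> carrier (orthogonal_group q) \<Longrightarrow> M \<in> carrier (orthogonal_group q)
      \<Longrightarrow> \<psi> (L \<circ> M) = \<psi> L * \<psi> M"
    and direct: "direct_isometry (poincare_group q) (of_lorentz L)"
  shows "\<psi> L > 0"
proof -
  let ?O = "orthogonal_group q" and ?G = "poincare_group q"
  interpret O: group ?O by (rule group_orthogonal_group)
  interpret G: group ?G by (rule group_poincare_group)
  have mult_O: "L \<otimes>\<^bsub>?O\<^esub> M = L \<circ> M" and one_O: "\<one>\<^bsub>?O\<^esub> = id" for L M
    by (simp_all add: orthogonal_group_def)
  have snd_carrier: "snd g \<in> carrier ?O" if "g \<in> carrier ?G" for g
    using that by (auto simp: poincare_group_def semidirect_product_def)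
  have snd_mult: "snd (g \<otimes>\<^bsub>?G\<^esub> h) = snd g \<circ> snd h" for g h
    by (simp add: poincare_group_def semidirect_product_def mult_O case_prod_beta)
  have snd_one: "snd \<one>\<^bsub>?G\<^esub> = id"
    by (simp add: poincare_group_def semidirect_product_def one_O)
  have nonzero: "\<psi> L \<noteq> 0" if "L \<in> carrier ?O" for L
    using comp[OF that O.inv_closed[OF that]] O.r_inv[OF that] one by (auto simp: mult_O one_O)
  \<comment> \<open>Membership in the carrier is carried through the induction because
    \<open>comp\<close> requires it.\<close>
  have "prod_of_squares ?G gs \<in> carrier ?G \<and> \<psi> (snd (prod_of_squares ?G gs)) > 0"
    if "set gs \<subseteq> carrier ?G" for gs
    using that
  proof (induction gs)
    case Nil
    then show ?case
      by (simp add: prod_of_squares_def snd_one id_def one[unfolded id_def])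
  next
    case (Cons g gs)
    define p where "p = prod_of_squares ?G gs"
    have g: "g \<in> carrier ?G" and p: "p \<in> carrier ?G" "\<psi> (snd p) > 0"
      using Cons by (auto simp: p_def)
    have eq: "prod_of_squares ?G (g # gs) = (g \<otimes>\<^bsub>?G\<^esub> g) \<otimes>\<^bsub>?G\<^esub> p"
      by (simp add: prod_of_squares_def p_def)
    have "\<psi> (snd (prod_of_squares ?G (g # gs))) = (\<psi> (snd g) * \<psi> (snd g)) * \<psi> (snd p)"
      using g p O.m_closed[of "snd g" "snd g"]
      by (simp add: eq snd_mult comp snd_carrier mult_O)
    also have "\<dots> > 0"
      using nonzero[OF snd_carrier[OF g]] p(2) by (simp add: zero_less_mult_iff) linarith
    finally show ?case
      using g p by (simp add: eq)
  qed
  with direct show ?thesis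
    unfolding direct_isometry_def of_lorentz_def by (metis snd_conv)
qed

lemma direct_isometry_spatial_rotation:
  assumes "rotation_matrix R"
  shows "direct_isometry (poincare_group minkowski_form) (of_lorentz (spatial_rotation R))"
proof -
  obtain u \<theta> where u: "norm u = 1" and R: "(*v) R = axis_rotation u \<theta>"
    using rotation_matrix_eq_axis_rotation[OF assms] .
  \<comment> \<open>The square root: rotation about the same axis by half the angle.\<close>
  let ?S = "\<lambda>(t :: real, x). (t, axis_rotation u (\<theta> / 2) x)"
  have "?S \<in> carrier (orthogonal_group minkowski_form)"
    using u by (intro spatial_in_orthogonal_group linear_axis_rotation norm_axis_rotation)
  moreover have "?S \<circ> ?S = spatial_rotation R"
    by (auto simp: fun_eq_iff spatial_rotation_def R axis_rotation_add[OF u])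
  ultimately show ?thesis
    using direct_isometry_of_lorentz_square by metis
qed

text \<open>The boost along \<open>u\<close> with half the rapidity is a square root.\<close>

lemma direct_isometry_lorentz_boost:
  assumes "norm u = 1"
  shows "direct_isometry (poincare_group minkowski_form) (of_lorentz (lorentz_boost u \<theta>))"
  using direct_isometry_of_lorentz_square[OF lorentz_boost_in_orthogonal_group[OF assms, of "\<theta> / 2"]]
  by (simp add: lorentz_boost_add[OF assms])

lemma indirect_isometry_if_time_reversing:
  assumes "L \<in> carrier (orthogonal_group minkowski_form)" "fst (L (1, 0)) < 0"
  shows "indirect_isometry (poincare_group minkowski_form) (of_lorentz L)"
proof -
  have "time_orientation id = 1" "time_orientation L = - 1"
    using assms(2) by (simp_all add: time_orientation_def)
  then show ?thesis
    using direct_isometry_character_pos[of time_orientation minkowski_form L] assms(1)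
      time_orientation_comp
    by (auto simp: indirect_isometry_def of_lorentz_in_poincare_group)
qed

text \<open>Meant for parity inversion, which preserves the time orientation.\<close>

lemma indirect_isometry_if_det_neg:
  assumes "L \<in> carrier (orthogonal_group minkowski_form)" "spacetime_det L < 0"
  shows "indirect_isometry (poincare_group minkowski_form) (of_lorentz L)"
proof -
  have "spacetime_det (L \<circ> M) = spacetime_det L * spacetime_det M"
    if "L \<in> carrier (orthogonal_group minkowski_form)"
      "M \<in> carrier (orthogonal_group minkowski_form)" for L M
    using that by (intro spacetime_det_comp) (auto simp: orthogonal_group_def)
  then show ?thesis
    using direct_isometry_character_pos[of spacetime_det minkowski_form L] assms
    by (auto simp: indirect_isometry_def of_lorentz_in_poincare_group spacetime_det_id)
qed

theorem mainTheorem7: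
  fixes q :: "spacetime \<Rightarrow> real"
  assumes "q = minkowski_form \<or> q = (\<lambda>v. - minkowski_form v)"
  shows "(\<forall>R. rotation_matrix R \<longrightarrow>
            direct_isometry (poincare_group q) (of_lorentz (spatial_rotation R)))
       \<and> (\<forall>u \<theta>. norm u = 1 \<longrightarrow>
            direct_isometry (poincare_group q) (of_lorentz (lorentz_boost u \<theta>)))
       \<and> indirect_isometry (poincare_group q) (of_lorentz parity_inversion)
       \<and> indirect_isometry (poincare_group q) (of_lorentz time_reversal)
       \<and> of_lorentz parity_inversion \<otimes>\<^bsub>poincare_group q\<^esub> of_lorentz time_reversal
          = of_lorentz time_reversal \<otimes>\<^bsub>poincare_group q\<^esub> of_lorentz parity_inversion
       \<and> indirect_isometry (poincare_group q)
            (of_lorentz parity_inversion \<otimes>\<^bsub>poincare_group q\<^esub> of_lorentz time_reversal)"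
proof -
  have q: "poincare_group q = poincare_group minkowski_form"
    using assms poincare_group_uminus by auto
  have lin: "linear parity_inversion" "linear time_reversal"
    using parity_inversion_in_orthogonal_group time_reversal_in_orthogonal_group
    by (simp_all add: orthogonal_group_def)
  have PT: "parity_inversion \<circ> time_reversal = time_reversal \<circ> parity_inversion"
    by (auto simp: fun_eq_iff parity_inversion_def time_reversal_def)
  have "parity_inversion \<circ> time_reversal \<in> carrier (orthogonal_group minkowski_form)"
    by (intro comp_in_orthogonal_group parity_inversion_in_orthogonal_group
        time_reversal_in_orthogonal_group)
  \<comment> \<open>\<open>PT\<close> is minus the identity, of determinant 1 in dimension four, so
    it is the time orientation that detects it.\<close>
  then have "indirect_isometry (poincare_group minkowski_form)
      (of_lorentz (parity_inversion \<circ> time_reversal))"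
    by (rule indirect_isometry_if_time_reversing)
      (simp add: parity_inversion_def time_reversal_def)
  moreover have "indirect_isometry (poincare_group minkowski_form) (of_lorentz time_reversal)"
    using time_reversal_in_orthogonal_group
    by (rule indirect_isometry_if_time_reversing) (simp add: time_reversal_def)
  moreover have "indirect_isometry (poincare_group minkowski_form) (of_lorentz parity_inversion)"
    using parity_inversion_in_orthogonal_group
    by (rule indirect_isometry_if_det_neg) (simp add: spacetime_det_parity_inversion)
  ultimately show ?thesis
    unfolding q
    by (simp add: mult_of_lorentz lin PT direct_isometry_spatial_rotation
        direct_isometry_lorentz_boost)
qed

end
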